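(* Every parakähler Lie algebra $(\mathcal G,\mathcal G^+,\mathcal G^-,\omega)$ is isomorphic, as a parakähler Lie algebra, to a phase space of the Lie algebra $\mathcal G^+$.
   Context: All algebras are finite-dimensional over a field $\mathbf F$. Parakähler Lie algebra $(\mathcal G,\mathcal G^+,\mathcal G^-,\omega)$: a Lie algebra $\mathcal G$ with a nondegenerate skew-symmetric bilinear form $\omega$ that is a 2-cocycle, $\omega([x,y],z)+\omega([y,z],x)+\omega([z,x],y)=0$, and two Lie subalgebras $\mathcal G^\pm$, each Lagrangian (equal to its orthogonal under $\omega$), with $\mathcal G=\mathcal G^+\oplus\mathcal G^-$ as vector spaces. Two parakähler Lie algebras $(\mathcal G_i,\mathcal G_i^+,\mathcal G_i^-,\omega_i)$, $i=1,2$, are isomorphic if there is a Lie algebra isomorphism $\varphi:\mathcal G_1\to\mathcal G_2$ with $\varphi(\mathcal G_1^+)=\mathcal G_2^+$, $\varphi(\mathcal G_1^-)=\mathcal G_2^-$ and $\omega_1(x,y)=\omega_2(\varphi(x),\varphi(y))$. Phase space of a Lie algebra $\mathcal H$: a Lie algebra structure on the vector space $\mathcal H\oplus\mathcal H^*$ such that $\mathcal H$ (with its given bracket) and $\mathcal H^*$ are Lie subalgebras and the form $\omega_p(x+a^*,y+b^* )=\langle a^*,y\rangle-\langle x,b^*\rangle$ is a 2-cocycle. It is regarded as the parakähler Lie algebra $(\mathcal H\oplus\mathcal H^*,\mathcal H,\mathcal H^*,\omega_p)$. *)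

theory Defs
  imports "HOL-Analysis.Product_Vector" "HOL-Library.Function_Algebras"
begin

text \<open>
  Algebras live on an explicit carrier, a finite-dimensional subspace of an ambient vector
  space. Linear and bilinear maps are constrained on the carrier only; their values elsewhere
  are irrelevant.
\<close>

definition linear_on ::
  "('f \<Rightarrow> 'v \<Rightarrow> 'v) \<Rightarrow> ('f \<Rightarrow> 'w \<Rightarrow> 'w) \<Rightarrow> 'v set \<Rightarrow> ('v::plus \<Rightarrow> 'w::plus) \<Rightarrow> bool"
  where "linear_on s1 s2 V f \<longleftrightarrow>
    (\<forall>x\<in>V. \<forall>y\<in>V. f (x + y) = f x + f y) \<and> (\<forall>c. \<forall>x\<in>V. f (s1 c x) = s2 c (f x))"

definition bilinear_on ::
  "('f \<Rightarrow> 'v \<Rightarrow> 'v) \<Rightarrow> ('f \<Rightarrow> 'w \<Rightarrow> 'w) \<Rightarrow> 'v set \<Rightarrow> ('v::plus \<Rightarrow> 'v \<Rightarrow> 'w::plus) \<Rightarrow> bool"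
  where "bilinear_on s1 s2 V B \<longleftrightarrow>
    (\<forall>x\<in>V. linear_on s1 s2 V (\<lambda>y. B x y)) \<and> (\<forall>y\<in>V. linear_on s1 s2 V (\<lambda>x. B x y))"

locale lie_algebra = vector_space s
  for s :: "'f::field \<Rightarrow> 'v::ab_group_add \<Rightarrow> 'v" +
  fixes L :: "'v set" and br :: "'v \<Rightarrow> 'v \<Rightarrow> 'v"
  assumes subspace_carrier: "subspace L"
    and finite_dim: "\<exists>B. finite B \<and> span B = L"
    and br_closed: "\<lbrakk>x \<in> L; y \<in> L\<rbrakk> \<Longrightarrow> br x y \<in> L"
    and br_bilinear: "bilinear_on s s L br"
    and br_alternating: "x \<in> L \<Longrightarrow> br x x = 0"
    and jacobi: "\<lbrakk>x \<in> L; y \<in> L; z \<in> L\<rbrakk> \<Longrightarrow>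
      br x (br y z) + br y (br z x) + br z (br x y) = 0"
begin

definition subalgebra :: "'v set \<Rightarrow> bool"
  where "subalgebra U \<longleftrightarrow> subspace U \<and> U \<subseteq> L \<and> (\<forall>x\<in>U. \<forall>y\<in>U. br x y \<in> U)"

definition two_cocycle :: "('v \<Rightarrow> 'v \<Rightarrow> 'f) \<Rightarrow> bool"
  where "two_cocycle \<omega> \<longleftrightarrow>
    (\<forall>x\<in>L. \<forall>y\<in>L. \<forall>z\<in>L. \<omega> (br x y) z + \<omega> (br y z) x + \<omega> (br z x) y = 0)"

end

locale parakaehler_lie_algebra = lie_algebra s G br
  for s :: "'f::field \<Rightarrow> 'v::ab_group_add \<Rightarrow> 'v" and G :: "'v set"
    and br :: "'v \<Rightarrow> 'v \<Rightarrow> 'v" +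
  fixes Gp Gm :: "'v set" and \<omega> :: "'v \<Rightarrow> 'v \<Rightarrow> 'f"
  assumes form_bilinear: "bilinear_on s (*) G \<omega>"
    and form_skew: "\<lbrakk>x \<in> G; y \<in> G\<rbrakk> \<Longrightarrow> \<omega> x y = - \<omega> y x"
    and form_nondegenerate: "\<lbrakk>x \<in> G; \<And>y. y \<in> G \<Longrightarrow> \<omega> x y = 0\<rbrakk> \<Longrightarrow> x = 0"
    and form_cocycle: "two_cocycle \<omega>"
    and subalgebra_plus: "subalgebra Gp"
    and subalgebra_minus: "subalgebra Gm"
    and lagrangian_plus: "{x \<in> G. \<forall>y\<in>Gp. \<omega> x y = 0} = Gp"
    and lagrangian_minus: "{x \<in> G. \<forall>y\<in>Gm. \<omega> x y = 0} = Gm"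
    and decomposition: "G = {x + y | x y. x \<in> Gp \<and> y \<in> Gm}"
    and direct: "Gp \<inter> Gm = {0}"

locale parakaehler_isomorphism =
  G1: parakaehler_lie_algebra s1 G1 br1 Gp1 Gm1 \<omega>1 +
  G2: parakaehler_lie_algebra s2 G2 br2 Gp2 Gm2 \<omega>2
  for s1 :: "'f::field \<Rightarrow> 'v::ab_group_add \<Rightarrow> 'v" and G1 br1 Gp1 Gm1 \<omega>1
    and s2 :: "'f \<Rightarrow> 'w::ab_group_add \<Rightarrow> 'w" and G2 br2 Gp2 Gm2 \<omega>2 +
  fixes \<phi> :: "'v \<Rightarrow> 'w"
  assumes linear_map: "linear_on s1 s2 G1 \<phi>"
    and bijective: "bij_betw \<phi> G1 G2"
    and bracket: "\<lbrakk>x \<in> G1; y \<in> G1\<rbrakk> \<Longrightarrow> \<phi> (br1 x y) = br2 (\<phi> x) (\<phi> y)"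
    and image_plus: "\<phi> ` Gp1 = Gp2"
    and image_minus: "\<phi> ` Gm1 = Gm2"
    and form: "\<lbrakk>x \<in> G1; y \<in> G1\<rbrakk> \<Longrightarrow> \<omega>1 x y = \<omega>2 (\<phi> x) (\<phi> y)"

text \<open>
  A linear functional on \<open>H\<close> is represented by its extension by \<open>0\<close> outside \<open>H\<close>, so that
  distinct elements of the dual differ on \<open>H\<close>; addition is the pointwise one.
\<close>

definition dual_space :: "('f::field \<Rightarrow> 'v::ab_group_add \<Rightarrow> 'v) \<Rightarrow> 'v set \<Rightarrow> ('v \<Rightarrow> 'f) set"
  where "dual_space s H = {a. linear_on s (*) H a \<and> (\<forall>x. x \<notin> H \<longrightarrow> a x = 0)}"

abbreviation phase_scale ::
  "('f::field \<Rightarrow> 'v::ab_group_add \<Rightarrow> 'v) \<Rightarrow> 'f \<Rightarrow> 'v \<times> ('v \<Rightarrow> 'f) \<Rightarrow> 'v \<times> ('v \<Rightarrow> 'f)"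
  where "phase_scale s \<equiv> module_prod.scale s (\<lambda>c a x. c * a x)"

definition phase_form :: "'v \<times> ('v \<Rightarrow> 'f::field) \<Rightarrow> 'v \<times> ('v \<Rightarrow> 'f) \<Rightarrow> 'f"
  where "phase_form u v = snd u (fst v) - snd v (fst u)"

locale phase_space =
  H: lie_algebra s H brH +
  P: lie_algebra "phase_scale s" "H \<times> dual_space s H" br
  for s :: "'f::field \<Rightarrow> 'v::ab_group_add \<Rightarrow> 'v" and H :: "'v set"
    and brH :: "'v \<Rightarrow> 'v \<Rightarrow> 'v"
    and br :: "'v \<times> ('v \<Rightarrow> 'f) \<Rightarrow> 'v \<times> ('v \<Rightarrow> 'f) \<Rightarrow> 'v \<times> ('v \<Rightarrow> 'f)" +
  assumes extends: "\<lbrakk>x \<in> H; y \<in> H\<rbrakk> \<Longrightarrow> br (x, 0) (y, 0) = (brH x y, 0)"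
    and subalgebra_dual: "P.subalgebra ({0} \<times> dual_space s H)"
    and phase_cocycle: "P.two_cocycle phase_form"

end

theory Submission
  imports Defs
begin

text \<open>
  The isomorphism sends \<open>z\<close> to the pair of its component in \<open>Gp\<close> and the restriction of
  \<open>\<omega> z\<close> to \<open>Gp\<close>; on \<open>Gp\<close> the latter only sees the component in \<open>Gm\<close>, since \<open>Gp\<close> is
  isotropic. Both subspaces being isotropic, this map carries \<open>\<omega>\<close> to the canonical form. It is
  injective because \<open>Gp\<close> is its own orthogonal and surjective because the functionals
  \<open>\<omega> y\<close>, \<open>y \<in> Gm\<close>, separate the points of the finite-dimensional space \<open>Gp\<close>. Transporting the
  bracket along it yields the phase space.
\<close>

subsection \<open>Linear maps on a subspace\<close>

lemma linear_on_add: "linear_on s1 s2 V f \<Longrightarrow> x \<in> V \<Longrightarrow> y \<in> V \<Longrightarrow> f (x + y) = f x + f y"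
  and linear_on_scale: "linear_on s1 s2 V f \<Longrightarrow> x \<in> V \<Longrightarrow> f (s1 c x) = s2 c (f x)"
  by (auto simp: linear_on_def)

lemma bilinear_on_left: "bilinear_on s1 s2 V B \<Longrightarrow> y \<in> V \<Longrightarrow> linear_on s1 s2 V (\<lambda>x. B x y)"
  and bilinear_on_right: "bilinear_on s1 s2 V B \<Longrightarrow> x \<in> V \<Longrightarrow> linear_on s1 s2 V (B x)"
  by (auto simp: bilinear_on_def)

lemma linear_on_subset: "linear_on s1 s2 V f \<Longrightarrow> U \<subseteq> V \<Longrightarrow> linear_on s1 s2 U f"
  by (simp add: linear_on_def subset_iff)

lemma bilinear_on_subset: "bilinear_on s1 s2 V B \<Longrightarrow> U \<subseteq> V \<Longrightarrow> bilinear_on s1 s2 U B"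
  unfolding bilinear_on_def by (meson linear_on_subset subsetD)

text \<open>Linearity on \<open>V\<close> evaluates a map only at points, sums and multiples in
  \<open>V\<close>, and these stay in \<open>V\<close>. This allows \<open>\<omega> z\<close> to be
  replaced by its restriction extended by zero.\<close>

lemma linear_on_cong:
  assumes "linear_on s1 s2 V f" "module.subspace s1 V" "module s1" "\<And>x. x \<in> V \<Longrightarrow> f x = g x"
  shows "linear_on s1 s2 V g"
  using assms module.subspace_add[OF assms(3,2)] module.subspace_scale[OF assms(3,2)]
  by (auto simp: linear_on_def)

lemma linear_on_zero:
  fixes f :: "'v::ab_group_add \<Rightarrow> 'w::ab_group_add"
  assumes "linear_on s1 s2 V f" "0 \<in> V"
  shows "f 0 = 0"
  using linear_on_add[OF assms(1,2,2)] by simp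

lemma linear_on_diff:
  fixes f :: "'v::ab_group_add \<Rightarrow> 'w::ab_group_add"
  assumes "linear_on s1 s2 V f" "x \<in> V" "y \<in> V" "x - y \<in> V"
  shows "f (x - y) = f x - f y"
  using linear_on_add[OF assms(1,4,3)] by simp

lemma linear_on_eq_on_span:
  fixes f g :: "'v::ab_group_add \<Rightarrow> 'w::ab_group_add"
  assumes m: "module s1" and f: "linear_on s1 s2 V f" and g: "linear_on s1 s2 V g"
    and V: "module.subspace s1 V" and B: "B \<subseteq> V" and eq: "\<And>b. b \<in> B \<Longrightarrow> f b = g b"
    and x: "x \<in> module.span s1 B"
  shows "f x = g x"
proof -
  interpret module s1 by (rule m)
  \<comment> \<open>Membership in \<open>V\<close> is carried through the induction because
    linearity is available only there.\<close>
  have "x \<in> V \<and> f x = g x"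
    using x
  proof (induction rule: span_induct_alt)
    case base
    then show ?case
      using linear_on_zero[OF f] linear_on_zero[OF g] subspace_0[OF V] by simp
  next
    case (step c b y)
    then have "b \<in> V" using B by auto
    with step show ?case
      using linear_on_add[OF f] linear_on_add[OF g] linear_on_scale[OF f] linear_on_scale[OF g]
        subspace_add[OF V] subspace_scale[OF V] eq by metis
  qed
  then show ?thesis by simp
qed

lemma subspace_image_linear_on:
  fixes f :: "'v::ab_group_add \<Rightarrow> 'w::ab_group_add"
  assumes m: "module s1" "module s2" and f: "linear_on s1 s2 U f" and U: "module.subspace s1 U"
  shows "module.subspace s2 (f ` U)"
  unfolding module.subspace_def[OF m(2)]
proof (intro conjI ballI allI)
  show "0 \<in> f ` U"
    using linear_on_zero[OF f] module.subspace_0[OF m(1) U] by (auto intro: rev_image_eqI)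
  show "x + y \<in> f ` U" if "x \<in> f ` U" "y \<in> f ` U" for x y
    using that module.subspace_add[OF m(1) U] by (auto simp flip: linear_on_add[OF f])
  show "s2 c x \<in> f ` U" if "x \<in> f ` U" for c x
    using that module.subspace_scale[OF m(1) U] by (auto simp flip: linear_on_scale[OF f])
qed

text \<open>Provides finite-dimensionality of an image: a finite spanning set is mapped to a finite
  spanning set.\<close>

lemma span_image_linear_on:
  fixes f :: "'v::ab_group_add \<Rightarrow> 'w::ab_group_add"
  assumes m: "module s1" "module s2" and f: "linear_on s1 s2 U f" and U: "module.subspace s1 U"
    and B: "module.span s1 B = U"
  shows "module.span s2 (f ` B) = f ` U"
proof
  have BU: "B \<subseteq> U" using module.span_superset[OF m(1)] B by blast
  then show "module.span s2 (f ` B) \<subseteq> f ` U"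
    by (intro module.span_minimal[OF m(2)] image_mono subspace_image_linear_on[OF m f U])
  have "x \<in> U \<and> f x \<in> module.span s2 (f ` B)" if "x \<in> module.span s1 B" for x
    using that
  proof (induction rule: module.span_induct_alt[OF m(1), consumes 1, case_names base step])
    case base
    then show ?case
      using linear_on_zero[OF f] module.subspace_0[OF m(1) U] module.span_zero[OF m(2)] by simp
  next
    case (step c b y)
    then have b: "b \<in> U" using BU by auto
    have "f (s1 c b + y) = s2 c (f b) + f y"
      using b step module.subspace_scale[OF m(1) U]
      by (simp add: linear_on_add[OF f] linear_on_scale[OF f])
    then show ?case
      using b step module.subspace_scale[OF m(1) U] module.subspace_add[OF m(1) U]
      by (simp add: module.span_add[OF m(2)] module.span_scale[OF m(2)] module.span_base[OF m(2)])
  qed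
  then show "f ` U \<subseteq> module.span s2 (f ` B)" using B by auto
qed

subsection \<open>Separating spaces of functionals\<close>

lemma vector_space_fun: "vector_space (\<lambda>(c::'f::field) (a::'v \<Rightarrow> 'f) x. c * a x)"
  by unfold_locales (auto simp: fun_eq_iff algebra_simps)

lemma sum_fun_apply: "(\<Sum>i\<in>I. g i) x = (\<Sum>i\<in>I. g i x)"
  by (induction I rule: infinite_finite_induct) auto

text \<open>A maximal independent subset of \<open>V\<close> spans \<open>V\<close>, and by exchange
  it has at most as many elements as \<open>T\<close>.\<close>

lemma finite_spanning_set_subspace:
  assumes "vector_space s" "module.subspace s V" "finite T" "V \<subseteq> module.span s T"
  shows "\<exists>B. finite B \<and> \<not> module.dependent s B \<and> B \<subseteq> V \<and> module.span s B = V"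
proof -
  interpret vector_space s by (rule assms)
  obtain B where B: "B \<subseteq> V" "independent B" "V \<subseteq> span B"
    using maximal_independent_subset by blast
  then have "finite B"
    using independent_span_bound[of T B] assms by auto
  moreover have "span B = V"
    using B assms(2) by (meson span_subspace)
  ultimately show ?thesis using B by blast
qed

text \<open>Induction on \<open>B\<close>, for all prescribed values \<open>f\<close> at once. The
  new vector \<open>c\<close> is made independent of the old ones by finding an element of
  \<open>F\<close> that vanishes on \<open>B\<close> but not at \<open>c\<close>; a multiple of it
  corrects the value at \<open>c\<close>.\<close>

lemma separating_functionals_interpolate:
  fixes s :: "'f::field \<Rightarrow> 'v::ab_group_add \<Rightarrow> 'v"
  assumes vs: "vector_space s" and V: "module.subspace s V"
    and F: "module.subspace (\<lambda>c a x. c * a x) F"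
    and lin: "\<And>a. a \<in> F \<Longrightarrow> linear_on s (*) V a"
    and sep: "\<And>x. x \<in> V \<Longrightarrow> (\<And>a. a \<in> F \<Longrightarrow> a x = 0) \<Longrightarrow> x = 0"
    and B: "finite B" "\<not> module.dependent s B" "B \<subseteq> V"
  shows "\<exists>a\<in>F. \<forall>b\<in>B. a b = f b"
  using B
proof (induction B arbitrary: f rule: finite_induct)
  interpret vector_space s by (rule vs)
  interpret F: vector_space "\<lambda>(c::'f) (a::'v \<Rightarrow> 'f) x. c * a x" by (rule vector_space_fun)
  case empty
  then show ?case using F.subspace_0[OF F] by auto
next
  interpret vector_space s by (rule vs)
  interpret F: vector_space "\<lambda>(c::'f) (a::'v \<Rightarrow> 'f) x. c * a x" by (rule vector_space_fun)
  case (insert c B)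
  have c: "c \<in> V" "c \<notin> span B" and BV: "B \<subseteq> V" and ind: "independent B"
    using insert.prems insert.hyps by (auto simp: independent_insert)
  \<comment> \<open>A dual family to \<open>B\<close> inside \<open>F\<close>: the induction
    hypothesis is applied to Kronecker delta values.\<close>
  obtain e where e: "\<And>b. e b \<in> F" "\<And>b b'. b' \<in> B \<Longrightarrow> e b b' = (if b' = b then 1 else 0)"
  proof -
    have "\<forall>b. \<exists>a\<in>F. \<forall>b'\<in>B. a b' = (if b' = b then 1 else 0)"
      by (intro allI insert.IH[OF ind BV])
    then obtain e where "\<forall>b. e b \<in> F \<and> (\<forall>b'\<in>B. e b b' = (if b' = b then 1 else 0))"
      using bchoice[of UNIV "\<lambda>b a. a \<in> F \<and> (\<forall>b'\<in>B. a b' = (if b' = b then 1 else 0))"] by blast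
    then show thesis by (intro that[of e]) auto
  qed
  \<comment> \<open>The part of \<open>c\<close> killed by every \<open>e b\<close> with
    \<open>b\<close> in \<open>B\<close>. It is nonzero because \<open>c\<close> lies outside
    \<open>span B\<close>, so some \<open>a\<close> in \<open>F\<close> detects it.\<close>
  define d where "d = c - (\<Sum>b\<in>B. s (e b c) b)"
  have sumB: "(\<Sum>b\<in>B. s (e b c) b) \<in> span B"
    by (intro span_sum span_scale span_base)
  have sumV: "(\<Sum>b\<in>B. s (e b c) b) \<in> V"
    using BV by (intro subspace_sum[OF V] subspace_scale[OF V]) auto
  have "d \<noteq> 0" using c sumB by (auto simp: d_def)
  moreover have dV: "d \<in> V" using sumV c subspace_diff[OF V] by (simp add: d_def)
  ultimately obtain a where a: "a \<in> F" "a d \<noteq> 0" using sep by blast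
  \<comment> \<open>The dual correction, now applied to \<open>a\<close>: \<open>z\<close> vanishes
    on \<open>B\<close>, while its value at \<open>c\<close> is \<open>a d\<close>.\<close>
  define z where "z = a - (\<Sum>b\<in>B. (\<lambda>x. a b * e b x))"
  have zF: "z \<in> F" unfolding z_def
    by (intro F.subspace_diff[OF F] F.subspace_sum[OF F] a F.subspace_scale[OF F] e)
  have z_apply: "z x = a x - (\<Sum>b\<in>B. a b * e b x)" for x
    by (simp add: z_def sum_fun_apply)
  have zB: "z b = 0" if "b \<in> B" for b
    using that insert.hyps by (simp add: z_apply e if_distrib sum.delta' cong: if_cong)
  \<comment> \<open>Stated for subsets so that the sum can be built up one term at a time while
    \<open>e\<close> stays fixed.\<close>
  have "a (\<Sum>b\<in>B'. s (e b c) b) = (\<Sum>b\<in>B'. e b c * a b)" if "B' \<subseteq> B" for B'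
    using finite_subset[OF that insert.hyps(1)] that
  proof (induction B' rule: finite_induct)
    case empty
    then show ?case using linear_on_zero[OF lin[OF a(1)] subspace_0[OF V]] by simp
  next
    case (insert b B')
    have bV: "b \<in> V" "B' \<subseteq> V" using insert.prems BV by auto
    then have "(\<Sum>b\<in>B'. s (e b c) b) \<in> V"
      by (intro subspace_sum[OF V] subspace_scale[OF V]) auto
    then show ?case
      using insert bV subspace_scale[OF V]
      by (simp add: linear_on_add[OF lin[OF a(1)]] linear_on_scale[OF lin[OF a(1)]])
  qed
  then have "z c = a d"
    using linear_on_diff[OF lin[OF a(1)] c(1) sumV dV[unfolded d_def]]
    by (simp add: z_apply d_def mult.commute)
  with a have zc: "z c \<noteq> 0" by simp
  obtain w where w: "w \<in> F" "\<forall>b\<in>B. w b = f b" using insert.IH[OF ind BV] by blast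
  define g where "g = w + (\<lambda>x. ((f c - w c) / z c) * z x)"
  have "g \<in> F" unfolding g_def
    by (intro F.subspace_add[OF F] w F.subspace_scale[OF F] zF)
  moreover have "\<forall>b\<in>insert c B. g b = f b"
    using zc zB w by (auto simp: g_def)
  ultimately show ?case by blast
qed

text \<open>Takes the place of a dimension count. Any functional is matched on a finite basis by an
  element of \<open>F\<close>; the two then agree on \<open>V\<close> by linearity and outside
  \<open>V\<close> because both are zero there.\<close>

lemma separating_subspace_eq_dual_space:
  fixes s :: "'f::field \<Rightarrow> 'v::ab_group_add \<Rightarrow> 'v"
  assumes vs: "vector_space s" and V: "module.subspace s V"
    and fin: "finite T" "V \<subseteq> module.span s T"
    and F: "module.subspace (\<lambda>c a x. c * a x) F" and sub: "F \<subseteq> dual_space s V"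
    and sep: "\<And>x. x \<in> V \<Longrightarrow> (\<And>a. a \<in> F \<Longrightarrow> a x = 0) \<Longrightarrow> x = 0"
  shows "F = dual_space s V"
proof
  interpret vector_space s by (rule vs)
  have lin: "linear_on s (*) V a" if "a \<in> dual_space s V" for a
    using that by (simp add: dual_space_def)
  obtain B where B: "finite B" "independent B" "B \<subseteq> V" "span B = V"
    using finite_spanning_set_subspace[OF vs V fin] by blast
  show "dual_space s V \<subseteq> F"
  proof
    fix f assume f: "f \<in> dual_space s V"
    obtain a where a: "a \<in> F" "\<forall>b\<in>B. a b = f b"
      using separating_functionals_interpolate[OF vs V F lin sep B(1-3)] sub by blast
    then have "a x = f x" for x
      using linear_on_eq_on_span[OF module_axioms lin lin V B(3)] sub f B(4)
      by (cases "x \<in> V") (auto simp: dual_space_def)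
    then have "a = f" by blast
    with a show "f \<in> F" by simp
  qed
qed (rule sub)

subsection \<open>Transport of structure\<close>

text \<open>The algebraic axioms restrict to \<open>U\<close>; finite-dimensionality comes from a
  basis of \<open>U\<close> bounded by a spanning set of \<open>L\<close>.\<close>

lemma (in lie_algebra) lie_algebra_subalgebra:
  assumes "subalgebra U"
  shows "lie_algebra s U br"
proof -
  have U: "subspace U" "U \<subseteq> L" "\<And>x y. x \<in> U \<Longrightarrow> y \<in> U \<Longrightarrow> br x y \<in> U"
    using assms by (auto simp: subalgebra_def)
  have "\<exists>B. finite B \<and> span B = U"
    using finite_spanning_set_subspace[OF vector_space_axioms U(1)] finite_dim U(2) by metis
  then show ?thesis
    using U bilinear_on_subset[OF br_bilinear U(2)] br_alternating jacobi
    by unfold_locales (simp_all add: subset_iff)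
qed

text \<open>Covers both transports: \<open>\<psi>\<close> is \<open>\<phi>\<close> itself for the
  bracket and the identity of the field for the form.\<close>

lemma bilinear_on_image:
  assumes m: "module s1" and V: "module.subspace s1 V"
    and \<phi>: "linear_on s1 s2 V \<phi>" and \<psi>: "linear_on s3 s4 W \<psi>"
    and B: "bilinear_on s1 s3 V B" and BW: "\<And>x y. x \<in> V \<Longrightarrow> y \<in> V \<Longrightarrow> B x y \<in> W"
    and eq: "\<And>x y. x \<in> V \<Longrightarrow> y \<in> V \<Longrightarrow> B' (\<phi> x) (\<phi> y) = \<psi> (B x y)"
  shows "bilinear_on s2 s4 (\<phi> ` V) B'"
proof -
  have add: "x + y \<in> V" and scale: "s1 c x \<in> V" if "x \<in> V" "y \<in> V" for x y c
    using module.subspace_add[OF m V] module.subspace_scale[OF m V] that by auto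
  show ?thesis
    unfolding bilinear_on_def linear_on_def
    using add scale BW
    by (auto simp: linear_on_add[OF \<phi>, symmetric] linear_on_scale[OF \<phi>, symmetric] eq
      linear_on_add[OF bilinear_on_left[OF B]] linear_on_add[OF bilinear_on_right[OF B]]
      linear_on_scale[OF bilinear_on_left[OF B]] linear_on_scale[OF bilinear_on_right[OF B]]
      linear_on_add[OF \<psi>] linear_on_scale[OF \<psi>])
qed

lemma lie_algebra_image:
  fixes \<phi> :: "'v::ab_group_add \<Rightarrow> 'w::ab_group_add"
  assumes lie: "lie_algebra s1 L br1" and vs: "vector_space s2" and \<phi>: "linear_on s1 s2 L \<phi>"
    and br: "\<And>x y. x \<in> L \<Longrightarrow> y \<in> L \<Longrightarrow> br2 (\<phi> x) (\<phi> y) = \<phi> (br1 x y)"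
  shows "lie_algebra s2 (\<phi> ` L) br2"
proof -
  interpret lie_algebra s1 L br1 by (rule lie)
  interpret V2: vector_space s2 by (rule vs)
  show ?thesis
  proof
    show "V2.subspace (\<phi> ` L)"
      by (rule subspace_image_linear_on[OF module_axioms V2.module_axioms \<phi> subspace_carrier])
    show "\<exists>B. finite B \<and> V2.span B = \<phi> ` L"
      using finite_dim
        span_image_linear_on[OF module_axioms V2.module_axioms \<phi> subspace_carrier]
      by (metis finite_imageI)
    show "bilinear_on s2 s2 (\<phi> ` L) br2"
      by (rule bilinear_on_image[OF module_axioms subspace_carrier \<phi> \<phi> br_bilinear br_closed br])
    show "br2 x y \<in> \<phi> ` L" if "x \<in> \<phi> ` L" "y \<in> \<phi> ` L" for x y
      using that br_closed by (auto simp: br)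
    have zero: "\<phi> 0 = 0" using linear_on_zero[OF \<phi> subspace_0[OF subspace_carrier]] .
    show "br2 x x = 0" if "x \<in> \<phi> ` L" for x
      using that by (auto simp: br br_alternating zero)
    show "br2 x (br2 y z) + br2 y (br2 z x) + br2 z (br2 x y) = 0"
      if "x \<in> \<phi> ` L" "y \<in> \<phi> ` L" "z \<in> \<phi> ` L" for x y z
      using that br_closed subspace_add[OF subspace_carrier]
      by (auto simp: br linear_on_add[OF \<phi>, symmetric] jacobi zero)
  qed
qed

text \<open>Each axiom on the image is pulled back along \<open>\<phi>\<close>. Injectivity gives
  bijectivity onto the image and keeps the images of \<open>Gp\<close> and \<open>Gm\<close>
  transversal.\<close>

lemma parakaehler_isomorphism_image:
  fixes \<phi> :: "'v::ab_group_add \<Rightarrow> 'w::ab_group_add"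
  assumes para: "parakaehler_lie_algebra s1 G br1 Gp Gm \<omega>1"
    and vs: "vector_space s2" and \<phi>: "linear_on s1 s2 G \<phi>" and inj: "inj_on \<phi> G"
    and br: "\<And>x y. x \<in> G \<Longrightarrow> y \<in> G \<Longrightarrow> br2 (\<phi> x) (\<phi> y) = \<phi> (br1 x y)"
    and form: "\<And>x y. x \<in> G \<Longrightarrow> y \<in> G \<Longrightarrow> \<omega>2 (\<phi> x) (\<phi> y) = \<omega>1 x y"
  shows "parakaehler_isomorphism s1 G br1 Gp Gm \<omega>1
    s2 (\<phi> ` G) br2 (\<phi> ` Gp) (\<phi> ` Gm) \<omega>2 \<phi>"
proof -
  interpret parakaehler_lie_algebra s1 G br1 Gp Gm \<omega>1 by (rule para)
  interpret G2: lie_algebra s2 "\<phi> ` G" br2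
    by (rule lie_algebra_image[OF lie_algebra_axioms vs \<phi>]) (rule br)
  have zero: "\<phi> 0 = 0" using linear_on_zero[OF \<phi> subspace_0[OF subspace_carrier]] .
  have G0: "0 \<in> G" by (rule subspace_0[OF subspace_carrier])
  have GpG: "Gp \<subseteq> G" and GmG: "Gm \<subseteq> G"
    using subalgebra_plus subalgebra_minus by (auto simp: subalgebra_def)
  have subalg: "G2.subalgebra (\<phi> ` U)" if "subalgebra U" for U
    using that subspace_image_linear_on[OF module_axioms G2.module_axioms linear_on_subset[OF \<phi>]]
    unfolding subalgebra_def G2.subalgebra_def by (auto simp: br subset_iff)
  \<comment> \<open>Taking orthogonals commutes with \<open>\<phi>\<close>, since
    \<open>\<phi>\<close> preserves the form; both Lagrangian conditions follow.\<close>
  have lagr: "{x \<in> \<phi> ` G. \<forall>y\<in>\<phi> ` U. \<omega>2 x y = 0} = \<phi> ` {x \<in> G. \<forall>y\<in>U. \<omega>1 x y = 0}"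
    if "U \<subseteq> G" for U
    using that by (auto simp: form subset_iff)
  interpret G2: parakaehler_lie_algebra s2 "\<phi> ` G" br2 "\<phi> ` Gp" "\<phi> ` Gm" \<omega>2
  proof
    show "bilinear_on s2 (*) (\<phi> ` G) \<omega>2"
      by (rule bilinear_on_image[where \<psi> = "\<lambda>c. c" and W = UNIV,
            OF module_axioms subspace_carrier \<phi> _ form_bilinear])
        (simp_all add: form linear_on_def)
    show "\<omega>2 x y = - \<omega>2 y x" if "x \<in> \<phi> ` G" "y \<in> \<phi> ` G" for x y
      using that by (auto simp: form intro: form_skew)
    show "x = 0" if "x \<in> \<phi> ` G" "\<And>y. y \<in> \<phi> ` G \<Longrightarrow> \<omega>2 x y = 0" for x
      using that form_nondegenerate zero form by (metis imageE imageI)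
    show "G2.two_cocycle \<omega>2"
      using form_cocycle br_closed by (auto simp: two_cocycle_def G2.two_cocycle_def br form)
    show "{x \<in> \<phi> ` G. \<forall>y\<in>\<phi> ` Gp. \<omega>2 x y = 0} = \<phi> ` Gp"
      using lagr[OF GpG] lagrangian_plus by simp
    show "{x \<in> \<phi> ` G. \<forall>y\<in>\<phi> ` Gm. \<omega>2 x y = 0} = \<phi> ` Gm"
      using lagr[OF GmG] lagrangian_minus by simp
    have "\<phi> ` G = \<phi> ` {x + y |x y. x \<in> Gp \<and> y \<in> Gm}"
      using decomposition by simp
    also have "\<dots> = {\<phi> x + \<phi> y |x y. x \<in> Gp \<and> y \<in> Gm}"
      using GpG GmG linear_on_add[OF \<phi>] by (force simp: image_iff subset_iff)
    finally show "\<phi> ` G = {x + y |x y. x \<in> \<phi> ` Gp \<and> y \<in> \<phi> ` Gm}"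
      by blast
    show "\<phi> ` Gp \<inter> \<phi> ` Gm = {0}"
      using inj_on_image_Int[OF inj GpG GmG] direct zero by simp
  qed (intro subalg subalgebra_plus subalgebra_minus)+
  show ?thesis
    by unfold_locales (auto simp: \<phi> br form inj inj_on_imp_bij_betw)
qed

subsection \<open>The phase space of a parakaehler Lie algebra\<close>

context parakaehler_lie_algebra
begin

section \<open>Projection onto \<open>Gp\<close> along \<open>Gm\<close>\<close>

lemma subspace_plus: "subspace Gp" and subspace_minus: "subspace Gm"
  and plus_subset: "Gp \<subseteq> G" and minus_subset: "Gm \<subseteq> G"
  using subalgebra_plus subalgebra_minus by (auto simp: subalgebra_def)

lemma isotropic_plus: "x \<in> Gp \<Longrightarrow> y \<in> Gp \<Longrightarrow> \<omega> x y = 0"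
  and isotropic_minus: "x \<in> Gm \<Longrightarrow> y \<in> Gm \<Longrightarrow> \<omega> x y = 0"
  using lagrangian_plus lagrangian_minus by auto

definition plus_part :: "'v \<Rightarrow> 'v"
  where "plus_part z = (THE x. x \<in> Gp \<and> z - x \<in> Gm)"

text \<open>Two candidates differ by an element of both \<open>Gp\<close> and \<open>Gm\<close>,
  hence by zero. Exhibiting a decomposition of \<open>z\<close> thus computes its
  projection.\<close>

lemma plus_part_eqI:
  assumes "x \<in> Gp" "z - x \<in> Gm"
  shows "plus_part z = x"
  unfolding plus_part_def
proof (rule the_equality)
  fix x' assume x': "x' \<in> Gp \<and> z - x' \<in> Gm"
  then have "x' - x \<in> Gp" "(z - x) - (z - x') \<in> Gm"
    using assms subspace_diff[OF subspace_plus] subspace_diff[OF subspace_minus] by blast+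
  then have "x' - x \<in> Gp \<inter> Gm" by simp
  then show "x' = x" unfolding direct by simp
qed (use assms in auto)

lemma plus_part_mem: "z \<in> G \<Longrightarrow> plus_part z \<in> Gp"
  and minus_part_mem: "z \<in> G \<Longrightarrow> z - plus_part z \<in> Gm"
proof -
  assume "z \<in> G"
  then obtain x where "x \<in> Gp" "z - x \<in> Gm" using decomposition by auto
  then show "plus_part z \<in> Gp" "z - plus_part z \<in> Gm" using plus_part_eqI by auto
qed

lemma linear_plus_part: "linear_on s s G plus_part"
  unfolding linear_on_def
proof (intro conjI ballI allI)
  fix x y assume "x \<in> G" "y \<in> G"
  then show "plus_part (x + y) = plus_part x + plus_part y"
    using plus_part_mem minus_part_mem subspace_add[OF subspace_plus]
      subspace_add[OF subspace_minus]
    by (intro plus_part_eqI) (auto simp: add_diff_add)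
next
  fix c x assume "x \<in> G"
  then show "plus_part (s c x) = s c (plus_part x)"
    using plus_part_mem minus_part_mem subspace_scale[OF subspace_plus]
      subspace_scale[OF subspace_minus]
    by (intro plus_part_eqI) (auto simp flip: scale_right_diff_distrib)
qed

section \<open>Functionals on \<open>Gp\<close> induced by the form\<close>

definition plus_functional :: "'v \<Rightarrow> 'v \<Rightarrow> 'f"
  where "plus_functional z x = (if x \<in> Gp then \<omega> z x else 0)"

lemma linear_plus_functional: "linear_on s (\<lambda>c a x. c * a x) G plus_functional"
  using linear_on_add[OF bilinear_on_left[OF form_bilinear]]
    linear_on_scale[OF bilinear_on_left[OF form_bilinear]] plus_subset
  by (auto simp: linear_on_def plus_functional_def fun_eq_iff subset_iff)

text \<open>The cut-off outside \<open>Gp\<close> selects the representative that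
  \<open>dual_space\<close> prescribes; on \<open>Gp\<close> it leaves the linear map
  \<open>\<omega> z\<close> unchanged.\<close>

lemma plus_functional_mem_dual: "z \<in> G \<Longrightarrow> plus_functional z \<in> dual_space s Gp"
  using linear_on_cong[OF linear_on_subset[OF bilinear_on_right[OF form_bilinear] plus_subset]
      subspace_plus module_axioms, of z "plus_functional z"]
  by (simp add: dual_space_def plus_functional_def)

text \<open>Identifies \<open>Gm\<close> with the dual of \<open>Gp\<close>. These functionals
  separate points: an element of \<open>Gp\<close> orthogonal to \<open>Gm\<close> lies in
  \<open>Gm\<close>, as \<open>Gm\<close> is Lagrangian, and so is zero.\<close>

lemma plus_functional_minus_image: "plus_functional ` Gm = dual_space s Gp"
proof -
  interpret F: vector_space "\<lambda>(c::'f) (a::'v \<Rightarrow> 'f) x. c * a x" by (rule vector_space_fun)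
  obtain T where T: "finite T" "Gp \<subseteq> span T" using finite_dim plus_subset by auto
  show ?thesis
  proof (rule separating_subspace_eq_dual_space[OF vector_space_axioms subspace_plus T])
    show "F.subspace (plus_functional ` Gm)"
      by (rule subspace_image_linear_on[OF module_axioms F.module_axioms
            linear_on_subset[OF linear_plus_functional minus_subset] subspace_minus])
    show "plus_functional ` Gm \<subseteq> dual_space s Gp"
      using plus_functional_mem_dual minus_subset by auto
    fix x assume x: "x \<in> Gp" "\<And>a. a \<in> plus_functional ` Gm \<Longrightarrow> a x = 0"
    then have "\<omega> y x = 0" if "y \<in> Gm" for y
      using that by (force simp: plus_functional_def)
    then have "\<forall>y\<in>Gm. \<omega> x y = 0"
      using form_skew x(1) plus_subset minus_subset by (metis neg_equal_0_iff_equal subsetD)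
    then have "x \<in> Gm" using lagrangian_minus x(1) plus_subset by blast
    with x(1) show "x = 0" using direct by blast
  qed
qed

section \<open>The comparison map and its compatibility with the forms\<close>

definition to_phase :: "'v \<Rightarrow> 'v \<times> ('v \<Rightarrow> 'f)"
  where "to_phase z = (plus_part z, plus_functional z)"

lemma vector_space_phase_scale: "vector_space (phase_scale s)"
proof -
  interpret F: vector_space "\<lambda>(c::'f) (a::'v \<Rightarrow> 'f) x. c * a x" by (rule vector_space_fun)
  interpret vector_space_prod s "\<lambda>(c::'f) (a::'v \<Rightarrow> 'f) x. c * a x" ..
  show ?thesis by (rule p.vector_space_axioms)
qed

lemma phase_scale_Pair: "phase_scale s c (x, a) = (s c x, \<lambda>y. c * a y)"
proof -
  interpret F: vector_space "\<lambda>(c::'f) (a::'v \<Rightarrow> 'f) x. c * a x" by (rule vector_space_fun)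
  interpret vector_space_prod s "\<lambda>(c::'f) (a::'v \<Rightarrow> 'f) x. c * a x" ..
  show ?thesis by (rule scale_prod)
qed

lemma linear_to_phase: "linear_on s (phase_scale s) G to_phase"
  using linear_plus_part linear_plus_functional
  by (simp add: linear_on_def to_phase_def phase_scale_Pair)

lemma to_phase_plus: "x \<in> Gp \<Longrightarrow> to_phase x = (x, 0)"
  using plus_part_eqI[of x x] subspace_0[OF subspace_minus]
  by (auto simp: to_phase_def plus_functional_def isotropic_plus fun_eq_iff)

lemma to_phase_minus: "y \<in> Gm \<Longrightarrow> to_phase y = (0, plus_functional y)"
  using plus_part_eqI[of 0 y] subspace_0[OF subspace_plus] by (simp add: to_phase_def)

lemma to_phase_plus_image: "to_phase ` Gp = Gp \<times> {0}"
  using to_phase_plus by force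

lemma to_phase_minus_image: "to_phase ` Gm = {0} \<times> dual_space s Gp"
  unfolding plus_functional_minus_image[symmetric] using to_phase_minus by force

text \<open>By additivity, a preimage of a pair is the sum of preimages of its two components, one
  in \<open>Gp\<close> and one in \<open>Gm\<close>.\<close>

lemma to_phase_image: "to_phase ` G = Gp \<times> dual_space s Gp"
proof
  show "to_phase ` G \<subseteq> Gp \<times> dual_space s Gp"
    using plus_part_mem plus_functional_mem_dual by (auto simp: to_phase_def)
  show "Gp \<times> dual_space s Gp \<subseteq> to_phase ` G"
  proof (clarify)
    fix x a assume x: "x \<in> Gp" and "a \<in> dual_space s Gp"
    then obtain y where y: "y \<in> Gm" "a = plus_functional y"
      using plus_functional_minus_image by blast
    have G: "x \<in> G" "y \<in> G" using x y plus_subset minus_subset by auto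
    then have "to_phase (x + y) = (x, a)"
      using linear_on_add[OF linear_to_phase G] x y by (simp add: to_phase_plus to_phase_minus)
    then show "(x, a) \<in> to_phase ` G" using subspace_add[OF subspace_carrier G] by force
  qed
qed

text \<open>A kernel element is orthogonal to \<open>Gp\<close>, hence in \<open>Gp\<close>; its
  \<open>Gp\<close>-component is zero, hence it is in \<open>Gm\<close> as well.\<close>

lemma inj_to_phase: "inj_on to_phase G"
proof (rule inj_onI)
  fix x y assume xy: "x \<in> G" "y \<in> G" "to_phase x = to_phase y"
  then have d: "x - y \<in> G" using subspace_diff[OF subspace_carrier] by blast
  then have "to_phase (x - y) = 0" using linear_on_diff[OF linear_to_phase xy(1,2)] xy(3) by simp
  then have 0: "plus_part (x - y) = 0" "plus_functional (x - y) = 0"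
    by (auto simp: to_phase_def zero_prod_def)
  have "\<forall>z\<in>Gp. \<omega> (x - y) z = 0"
    using fun_cong[OF 0(2)] by (metis plus_functional_def zero_fun_apply)
  then have "x - y \<in> Gp" using lagrangian_plus d by blast
  moreover have "x - y \<in> Gm" using minus_part_mem[OF d] 0(1) by simp
  ultimately have "x - y \<in> Gp \<inter> Gm" by simp
  then show "x = y" unfolding direct by simp
qed

text \<open>Split both arguments along \<open>Gp\<close> and \<open>Gm\<close>. Isotropy of the two
  summands leaves only the cross terms of \<open>\<omega> x y\<close>, and skew-symmetry matches
  their signs with the canonical form.\<close>

lemma phase_form_to_phase:
  assumes "x \<in> G" "y \<in> G"
  shows "phase_form (to_phase x) (to_phase y) = \<omega> x y"
proof -
  note add = linear_on_add[OF bilinear_on_left[OF form_bilinear]]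
    linear_on_add[OF bilinear_on_right[OF form_bilinear]]
  define x1 x2 y1 y2 where "x1 = plus_part x" "x2 = x - x1" "y1 = plus_part y" "y2 = y - y1"
  note defs = this
  have mem: "x1 \<in> Gp" "x2 \<in> Gm" "y1 \<in> Gp" "y2 \<in> Gm"
    using assms plus_part_mem minus_part_mem by (auto simp: defs)
  then have G: "x1 \<in> G" "x2 \<in> G" "y1 \<in> G" "y2 \<in> G" using plus_subset minus_subset by auto
  have eq: "x = x1 + x2" "y = y1 + y2" by (auto simp: defs)
  have "phase_form (to_phase x) (to_phase y) = \<omega> x y1 - \<omega> y x1"
    using mem by (simp add: phase_form_def to_phase_def plus_functional_def flip: defs(1,3))
  also have "\<dots> = \<omega> x2 y1 - \<omega> y2 x1"
    unfolding eq using G mem by (simp add: add isotropic_plus)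
  also have "\<dots> = \<omega> x2 y1 + \<omega> x1 y2" by (simp add: form_skew[OF G(4,1)])
  also have "\<dots> = \<omega> x y"
    unfolding eq using G mem subspace_add[OF subspace_carrier]
    by (simp add: add isotropic_plus isotropic_minus)
  finally show ?thesis .
qed

section \<open>The transported bracket\<close>

definition phase_bracket ::
  "'v \<times> ('v \<Rightarrow> 'f) \<Rightarrow> 'v \<times> ('v \<Rightarrow> 'f) \<Rightarrow> 'v \<times> ('v \<Rightarrow> 'f)"
  where "phase_bracket u v =
    to_phase (br (inv_into G to_phase u) (inv_into G to_phase v))"

lemma phase_bracket_to_phase:
  "x \<in> G \<Longrightarrow> y \<in> G \<Longrightarrow> phase_bracket (to_phase x) (to_phase y) = to_phase (br x y)"
  by (simp add: phase_bracket_def inv_into_f_f[OF inj_to_phase])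

lemma parakaehler_isomorphism_to_phase:
  "parakaehler_isomorphism s G br Gp Gm \<omega>
    (phase_scale s) (Gp \<times> dual_space s Gp) phase_bracket
    (Gp \<times> {0}) ({0} \<times> dual_space s Gp) phase_form to_phase"
  unfolding to_phase_image[symmetric] to_phase_plus_image[symmetric] to_phase_minus_image[symmetric]
  by (rule parakaehler_isomorphism_image[OF parakaehler_lie_algebra_axioms vector_space_phase_scale
        linear_to_phase inj_to_phase])
    (fact phase_bracket_to_phase phase_form_to_phase)+

text \<open>Since \<open>to_phase\<close> is the inclusion \<open>x\<close> to \<open>(x, 0)\<close>
  on the subalgebra \<open>Gp\<close>, the transported bracket extends the given one. The other
  conditions are part of the transported parakaehler structure.\<close>

lemma phase_space_phase_bracket: "phase_space s Gp br phase_bracket"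
proof -
  interpret I: parakaehler_isomorphism s G br Gp Gm \<omega>
    "phase_scale s" "Gp \<times> dual_space s Gp" phase_bracket
    "Gp \<times> {0}" "{0} \<times> dual_space s Gp" phase_form to_phase
    by (rule parakaehler_isomorphism_to_phase)
  interpret H: lie_algebra s Gp br by (rule lie_algebra_subalgebra[OF subalgebra_plus])
  show ?thesis
  proof
    fix x y assume xy: "x \<in> Gp" "y \<in> Gp"
    then have "to_phase (br x y) = phase_bracket (to_phase x) (to_phase y)"
      by (simp add: phase_bracket_to_phase subsetD[OF plus_subset])
    then show "phase_bracket (x, 0) (y, 0) = (br x y, 0)"
      using xy H.br_closed by (simp add: to_phase_plus)
  qed (rule I.G2.subalgebra_minus I.G2.form_cocycle)+
qed

end

theorem proposition2p4:
  fixes s :: "'f::field \<Rightarrow> 'v::ab_group_add \<Rightarrow> 'v"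
    and G Gp Gm :: "'v set"
    and br :: "'v \<Rightarrow> 'v \<Rightarrow> 'v"
    and \<omega> :: "'v \<Rightarrow> 'v \<Rightarrow> 'f"
  assumes "parakaehler_lie_algebra s G br Gp Gm \<omega>"
  shows "\<exists>brP \<phi>. phase_space s Gp br brP \<and>
    parakaehler_isomorphism s G br Gp Gm \<omega>
      (phase_scale s) (Gp \<times> dual_space s Gp) brP
      (Gp \<times> {0}) ({0} \<times> dual_space s Gp) phase_form \<phi>"
  using parakaehler_lie_algebra.phase_space_phase_bracket[OF assms]
    parakaehler_lie_algebra.parakaehler_isomorphism_to_phase[OF assms]
  by blast

end
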